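(* Let $\mathcal{K}_1=K(-1,0,\alpha,a)$ and $\mathcal{K}_2=K(1,0,\beta,b)$ be the circles of curvature at the startpoint and at the endpoint, respectively, of a short spiral arc going from $(-1,0)$ to $(1,0)$. Let $\mathcal{K}^\star_1=K(-1,0,\alpha^\star,a^\star)$ and $\mathcal{K}^\star_2=K(1,0,\beta^\star,b^\star)$ be the circles of curvature at the startpoint and at the endpoint, respectively, of another short spiral arc going from $(-1,0)$ to $(1,0)$. Suppose that $$\sigma(\mathcal{K}_1,\mathcal{K}_2)=\sigma(\mathcal{K}^\star_1,\mathcal{K}^\star_2),\qquad Q(\mathcal{K}_1,\mathcal{K}_2)=Q(\mathcal{K}^\star_1,\mathcal{K}^\star_2).$$ Then the transformation $$W(z;z_0)=\frac{z+z_0}{1+z_0z}$$ with $$z_0=\frac{r_0e^{\mathrm{i}\lambda_0}-1}{r_0e^{\mathrm{i}\lambda_0}+1},\qquad \lambda_0=\alpha^\star-\alpha=\beta-\beta^\star,\qquad r_0=\frac{a+\sin\alpha}{a^\star+\sin\alpha^\star}=\frac{b^\star-\sin\beta^\star}{b-\sin\beta}>0,$$ maps the first pair of circles to the second one: $W(\mathcal{K}_1;z_0)=\mathcal{K}^\star_1$ and $W(\mathcal{K}_2;z_0)=\mathcal{K}^\star_2$.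
   Context: The plane is identified with $\mathbb{C}$, $z=x+\mathrm{i}y$. $K(x,y,\tau,k)$ denotes the oriented circle (a straight line if $k=0$) through the point $(x,y)$, with tangent direction $e^{\mathrm{i}\tau}$ at this point and signed curvature $k$ (positive for counterclockwise rotation). The image of such a circle under a map $W$ fixing the marked point is understood as an oriented circle with the same marked point; so equality of $W(K(\pm1,0,\tau,k))$ with $K(\pm1,0,\tau^\star,k^\star)$ means that the image has at that point the tangent direction $e^{\mathrm{i}\tau^\star}$ and the signed curvature $k^\star$. The map $W(\cdot;z_0)$, $z_0\neq\pm1$, fixes the points $1$ and $-1$; when $r_0e^{\mathrm{i}\lambda_0}=-1$, i.e. $z_0=\infty$, $W(z;\infty)$ means $1/z$. A spiral arc is a planar arc whose signed curvature is a monotone, nonconstant function of the parameter. A spiral arc from $A$ to $B$ is short if its tangent vector never achieves the direction of the vector $\overrightarrow{BA}$ (opposite to its chord), except, possibly, at the endpoints. The circle of curvature of an arc at one of its points is $K(x,y,\tau,k)$ with $(x,y)$ that point, $\tau$ the angle of the tangent vector and $k$ the curvature there. For short arcs from $(-1,0)$ to $(1,0)$, with boundary tangent angles $\alpha$ (start), $\beta$ (end), the angles are normalized by: $-\pi<\alpha,\beta\le\pi$ if the curvature is increasing, and $-\pi\le\alpha,\beta<\pi$ if the curvature is decreasing. For a pair $\mathcal{K}_1=K(-1,0,\alpha,a)$, $\mathcal{K}_2=K(1,0,\beta,b)$: $$\sigma(\mathcal{K}_1,\mathcal{K}_2)=\alpha+\beta,\qquad Q(\mathcal{K}_1,\mathcal{K}_2)=(a+\sin\alpha)(b-\sin\beta)+\sin^2\frac{\alpha+\beta}{2}.$$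 *)

theory Defs
  imports "HOL-Analysis.Analysis"
begin

text \<open>
  \<open>OCircle x y \<tau> \<kappa>\<close> is the oriented circle \<open>K(x,y,\<tau>,k)\<close>. The angle \<open>\<tau>\<close> is kept as a real number and
  not modulo \<open>2 * pi\<close>, because \<open>sigma\<close> below depends on the chosen value.
\<close>
datatype ocircle =
  OCircle (circ_x: real) (circ_y: real) (circ_angle: real) (circ_curv: real)

definition circ_point :: "ocircle \<Rightarrow> complex" where
  "circ_point C = Complex (circ_x C) (circ_y C)"

text \<open>Arc-length parametrization of the circle (or line), with the marked point at parameter 0.\<close>
definition circ_curve :: "ocircle \<Rightarrow> real \<Rightarrow> complex" where
  "circ_curve C s = circ_point C + cis (circ_angle C) *
     (if circ_curv C = 0 then of_real s
      else (cis (circ_curv C * s) - 1) / (\<i> * of_real (circ_curv C)))"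

text \<open>
  The curve \<open>\<gamma>\<close> is regular and twice differentiable at \<open>t\<close>, with tangent direction \<open>cis \<tau>\<close>
  and signed curvature \<open>\<kappa> = (x' y'' - y' x'') / (x'\<^sup>2 + y'\<^sup>2) powr (3/2)\<close> there.
\<close>
definition has_direction_curvature ::
    "(real \<Rightarrow> complex) \<Rightarrow> real \<Rightarrow> real \<Rightarrow> real \<Rightarrow> bool" where
  "has_direction_curvature \<gamma> t \<tau> \<kappa> \<longleftrightarrow>
     (\<exists>\<gamma>' w. (\<forall>\<^sub>F u in nhds t. (\<gamma> has_vector_derivative \<gamma>' u) (at u)) \<and>
             (\<gamma>' has_vector_derivative w) (at t) \<and>
             \<gamma>' t \<noteq> 0 \<and>
             sgn (\<gamma>' t) = cis \<tau> \<and>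
             Im (cnj (\<gamma>' t) * w) / norm (\<gamma>' t) ^ 3 = \<kappa>)"

text \<open>
  The image of \<open>C\<close> under a map fixing its marked point is \<open>C'\<close>: same marked point, and there
  the image curve has the tangent direction and the signed curvature of \<open>C'\<close>.
\<close>
definition maps_ocircle :: "(complex \<Rightarrow> complex) \<Rightarrow> ocircle \<Rightarrow> ocircle \<Rightarrow> bool" where
  "maps_ocircle f C C' \<longleftrightarrow>
     f (circ_point C) = circ_point C \<and>
     circ_point C' = circ_point C \<and>
     has_direction_curvature (f \<circ> circ_curve C) 0 (circ_angle C') (circ_curv C')"

text \<open>These are used only for pairs with marked points \<open>-1\<close> and \<open>1\<close>.\<close>
definition sigma :: "ocircle \<Rightarrow> ocircle \<Rightarrow> real" where
  "sigma C1 C2 = circ_angle C1 + circ_angle C2"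

definition Qinv :: "ocircle \<Rightarrow> ocircle \<Rightarrow> real" where
  "Qinv C1 C2 = (circ_curv C1 + sin (circ_angle C1)) * (circ_curv C2 - sin (circ_angle C2))
                 + (sin ((circ_angle C1 + circ_angle C2) / 2))\<^sup>2"

text \<open>
  An arc of length \<open>L\<close>, parametrized by arc length: \<open>z\<close> is the position, \<open>cis (\<theta> s)\<close> the unit
  tangent, \<open>k\<close> the signed curvature. The integral form of \<open>\<theta>' = k\<close> admits jumps of \<open>k\<close> in the
  interior (as in biarcs). One-sided continuity at 0 and \<open>L\<close> makes \<open>k 0\<close> and \<open>k L\<close> the
  actual boundary curvatures, i.e. the one-sided derivatives of \<open>\<theta>\<close>; without it they could be
  altered without altering the arc. If \<open>\<theta>\<close> is differentiable with monotone derivative \<open>k\<close>,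
  the continuity is automatic.
\<close>
definition arc_with_curvature ::
    "real \<Rightarrow> (real \<Rightarrow> complex) \<Rightarrow> (real \<Rightarrow> real) \<Rightarrow> (real \<Rightarrow> real) \<Rightarrow> bool" where
  "arc_with_curvature L z \<theta> k \<longleftrightarrow>
     0 < L \<and>
     (\<forall>s\<in>{0..L}. (z has_vector_derivative cis (\<theta> s)) (at s within {0..L})) \<and>
     (\<forall>s\<in>{0..L}. (k has_integral (\<theta> s - \<theta> 0)) {0..s}) \<and>
     continuous (at 0 within {0..L}) k \<and>
     continuous (at L within {0..L}) k"

definition spiral_arc ::
    "real \<Rightarrow> (real \<Rightarrow> complex) \<Rightarrow> (real \<Rightarrow> real) \<Rightarrow> (real \<Rightarrow> real) \<Rightarrow> bool" where
  "spiral_arc L z \<theta> k \<longleftrightarrow>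
     arc_with_curvature L z \<theta> k \<and>
     (mono_on {0..L} k \<or> antimono_on {0..L} k) \<and>
     \<not> k constant_on {0..L}"

definition short_arc :: "real \<Rightarrow> (real \<Rightarrow> complex) \<Rightarrow> (real \<Rightarrow> real) \<Rightarrow> bool" where
  "short_arc L z \<theta> \<longleftrightarrow> (\<forall>s\<in>{0<..<L}. cis (\<theta> s) \<noteq> sgn (z 0 - z L))"

definition short_spiral ::
    "real \<Rightarrow> (real \<Rightarrow> complex) \<Rightarrow> (real \<Rightarrow> real) \<Rightarrow> (real \<Rightarrow> real) \<Rightarrow> bool" where
  "short_spiral L z \<theta> k \<longleftrightarrow> spiral_arc L z \<theta> k \<and> short_arc L z \<theta>"

definition circle_of_curvature ::
    "(real \<Rightarrow> complex) \<Rightarrow> (real \<Rightarrow> real) \<Rightarrow> (real \<Rightarrow> real) \<Rightarrow> real \<Rightarrow> ocircle \<Rightarrow> bool" where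
  "circle_of_curvature z \<theta> k s C \<longleftrightarrow>
     circ_point C = z s \<and> cis (circ_angle C) = cis (\<theta> s) \<and> circ_curv C = k s"

definition normalized_angles :: "real \<Rightarrow> (real \<Rightarrow> real) \<Rightarrow> real \<Rightarrow> real \<Rightarrow> bool" where
  "normalized_angles L k \<alpha> \<beta> \<longleftrightarrow>
     (mono_on {0..L} k \<longrightarrow> \<alpha> \<in> {-pi<..pi} \<and> \<beta> \<in> {-pi<..pi}) \<and>
     (antimono_on {0..L} k \<longrightarrow> \<alpha> \<in> {-pi..<pi} \<and> \<beta> \<in> {-pi..<pi})"

text \<open>
  The parameter lives in the extended plane, \<open>None\<close> standing for infinity; \<open>ext_quot\<close> is the
  quotient there of two numbers that are not both 0.
\<close>
definition ext_quot :: "complex \<Rightarrow> complex \<Rightarrow> complex option" where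
  "ext_quot u v = (if v = 0 then None else Some (u / v))"

text \<open>The value at the pole is immaterial: the pole differs from \<open>1\<close> and \<open>-1\<close> when the parameter does.\<close>
fun W :: "complex \<Rightarrow> complex option \<Rightarrow> complex" where
  "W z (Some z0) = (z + z0) / (1 + z0 * z)"
| "W z None = 1 / z"

end

theory Submission imports Defs begin

text \<open>
  Write \<open>A = a + sin \<alpha>\<close> and \<open>B = b - sin \<beta>\<close>. Up to the factor 4, these are the powers of the opposite
  endpoint of the chord with respect to the two boundary circles, multiplied by the curvatures. The
  core of the proof is a sign statement for short spirals (\<open>short_spiral_boundary_signs\<close>): if the
  curvature increases, then
  \<open>A < 0 < B\<close> and \<open>\<sigma> > 0\<close>; if it decreases, all three signs are reversed. Since the two pairs have
  the same \<open>\<sigma>\<close>, both spirals are of the same kind, so that \<open>A / A' > 0\<close>. As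
  \<open>Q = A * B + sin\<^sup>2 (\<sigma> / 2)\<close>, equality of \<open>Q\<close> and \<open>\<sigma>\<close> gives \<open>A * B = A' * B'\<close>, so both
  expressions for the ratio \<open>r0\<close> agree and define a positive number.

  With \<open>\<rho> = r0 * cis lam0\<close>, the map \<open>W\<close> is the Moebius map \<open>M\<close> that fixes \<open>1\<close> and \<open>-1\<close> and has
  derivative \<open>\<rho>\<close> at \<open>-1\<close> and \<open>1 / \<rho>\<close> at \<open>1\<close>. It therefore turns tangents at \<open>-1\<close> by \<open>lam0\<close> and at
  \<open>1\<close> by \<open>- lam0\<close>. A holomorphic map \<open>f\<close> changes the curvature of a curve with unit tangent \<open>t\<close> from
  \<open>\<kappa>\<close> to \<open>(\<kappa> + Im (f'' / f' * t)) / norm f'\<close>; at the two fixed points of \<open>M\<close> this says exactly that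
  \<open>A\<close> is divided by \<open>r0\<close> and \<open>B\<close> multiplied by \<open>r0\<close>.

  For the sign statement, conjugation reduces everything to increasing curvature, and a multiple of
  \<open>2 * pi\<close> can be subtracted from the tangent angle \<open>\<theta>\<close> so that it lies between \<open>-pi\<close> and \<open>pi\<close>,
  because a short arc omits the direction \<open>-1\<close>.

  \<^item> \<open>A < 0 < B\<close> is a form of Kneser's theorem on nested osculating circles. Let \<open>C s\<close> be the power of
    a fixed point \<open>p\<close> with respect to the circle of curvature at \<open>s\<close>, scaled by the curvature.
    Formally \<open>dC = (norm (p - z))\<^sup>2 dk\<close>, so \<open>C\<close> increases with \<open>k\<close>; and \<open>C\<close> vanishes whenever
    \<open>p\<close> lies on the circle, in particular when \<open>p = z s\<close>. With \<open>p\<close> the end of the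
    arc this bounds \<open>C 0\<close>, a multiple of \<open>A\<close>; with \<open>p\<close> its start it bounds \<open>C L\<close>, a multiple
    of \<open>B\<close>. The inequalities are strict because the
    arc is simple (\<open>z_injective\<close>): for a point \<open>p\<close> visited twice \<open>C\<close> would be 0 from the first
    visit to the second, which makes the arc run through a full circle between consecutive visits,
    and the tangent of a short arc does not turn that far.

  \<^item> \<open>\<sigma> > 0\<close> is a form of Vogt's theorem. Since \<open>\<theta>\<close> is convex, it vanishes at exactly one \<open>s1\<close> if its
    boundary values have opposite signs, and then \<open>(k - k s1) * sin \<theta>\<close> has constant sign. The
    integral of \<open>sin \<theta>\<close> is 0, because the chord is horizontal, and that of \<open>k * sin \<theta>\<close> is
    \<open>cos (\<theta> 0) - cos (\<theta> L)\<close>, because \<open>k = \<theta>'\<close>. The sign of this difference decides which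
    of the two boundary values is larger in absolute value. If their signs are not opposite, their
    sum is positive because they cannot both be nonpositive.
\<close>

section \<open>Functions differentiable off a countable set\<close>

text \<open>
  If \<open>D b < D a\<close>, some value \<open>c\<close> strictly between them is not taken on the countable exceptional set.
  At the last point where \<open>D\<close> is at least \<open>c\<close> the derivative would then exist and be positive,
  although \<open>D\<close> is below \<open>c\<close> afterwards.
\<close>
lemma nondecreasing_if_derivative_pos_off_countable:
  fixes D :: "real \<Rightarrow> real"
  assumes "a \<le> b" and S: "countable S" and cont: "continuous_on {a..b} D"
    and deriv: "\<And>x. x \<in> {a..b} - S \<Longrightarrow> \<exists>d>0. (D has_real_derivative d) (at x within {a..b})"
  shows "D a \<le> D b"
proof (rule ccontr)
  assume "\<not> D a \<le> D b"
  then have "D b < D a" by simp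
  then have "uncountable {D b<..<D a}"
    by (simp add: uncountable_open_interval)
  then obtain c where c: "c \<in> {D b<..<D a}" "c \<notin> D ` S"
    using S by (metis countable_image countable_subset subsetI)
  define T where "T = {a..b} \<inter> D -` {c..}"
  have "closed T"
    unfolding T_def by (rule continuous_closed_preimage[OF cont]) auto
  then have "compact T"
    by (metis T_def compact_Icc compact_Int_closed inf.absorb_iff2 inf_le1)
  moreover have "a \<in> T"
    using c \<open>a \<le> b\<close> by (auto simp: T_def)
  ultimately obtain m where m: "m \<in> T" "\<And>t. t \<in> T \<Longrightarrow> t \<le> m"
    using compact_attains_sup[of T] by auto
  have mb: "m \<in> {a..b}" and mc: "c \<le> D m" and "m < b"
    using m(1) c by (auto simp: T_def less_le)
  have below: "D t < c" if "m < t" "t \<le> b" for t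
    using m(2)[of t] that mb by (fastforce simp: T_def)
  have "D m = c"
  proof (rule ccontr)
    assume "D m \<noteq> c"
    then have "c < D m" using mc by simp
    then obtain x where "m \<le> x" "x \<le> b" "D x = c"
      using IVT2'[of D b c m] c \<open>m < b\<close> mb continuous_on_subset[OF cont, of "{m..b}"] by auto
    then show False
      using below[of x] \<open>D m \<noteq> c\<close> by (cases "x = m") auto
  qed
  then have "m \<notin> S" using c by auto
  then obtain d where "d > 0" "(D has_real_derivative d) (at m within {a..b})"
    using deriv mb by auto
  then obtain e where e: "e > 0" "\<And>h. h > 0 \<Longrightarrow> m + h \<in> {a..b} \<Longrightarrow> h < e \<Longrightarrow> D m < D (m + h)"
    using has_real_derivative_pos_inc_right by blast
  define h where "h = min (e / 2) (b - m)"
  have "h > 0" "h < e" "m + h \<le> b" "m + h \<in> {a..b}"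
    using e(1) \<open>m < b\<close> mb by (auto simp: h_def min_def field_simps)
  then show False
    using e(2)[of h] below[of "m + h"] \<open>D m = c\<close> by simp
qed

lemma constant_if_derivative_zero_off_countable:
  fixes D :: "real \<Rightarrow> real"
  assumes "a \<le> b" and S: "countable S" and cont: "continuous_on {a..b} D"
    and deriv: "\<And>x. x \<in> {a..b} - S \<Longrightarrow> (D has_real_derivative 0) (at x within {a..b})"
  shows "D b = D a"
proof (cases "a = b")
  case False
  then have ab: "0 < b - a" using \<open>a \<le> b\<close> by simp
  \<comment> \<open>The slope \<open>c\<close> makes the derivative positive and costs a total rise of only \<open>e\<close>.\<close>
  have one_sided: "g a \<le> g b + e"
    if e: "e > 0" and g: "continuous_on {a..b} g"
      and g0: "\<And>x. x \<in> {a..b} - S \<Longrightarrow> (g has_real_derivative 0) (at x within {a..b})" for g :: "real \<Rightarrow> real" and e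
  proof -
    define c where "c = e / (b - a)"
    have "c > 0" using ab e by (simp add: c_def)
    have "g a + c * a \<le> g b + c * b"
    proof (rule nondecreasing_if_derivative_pos_off_countable[OF \<open>a \<le> b\<close> S])
      show "continuous_on {a..b} (\<lambda>x. g x + c * x)"
        by (intro continuous_intros g)
      show "\<exists>d>0. ((\<lambda>x. g x + c * x) has_real_derivative d) (at x within {a..b})"
        if "x \<in> {a..b} - S" for x
        by (rule exI[of _ c]) (auto intro!: derivative_eq_intros g0[OF that] \<open>c > 0\<close>)
    qed
    moreover have "c * (b - a) = e"
      using ab by (simp add: c_def)
    then have "c * b - c * a = e"
      by (simp add: algebra_simps)
    ultimately show ?thesis by linarith
  qed
  have "D a \<le> D b"
    by (rule field_le_epsilon) (rule one_sided[OF _ cont deriv])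
  moreover have "- D a \<le> - D b"
    by (rule field_le_epsilon, rule one_sided)
       (auto intro!: continuous_intros cont derivative_eq_intros deriv)
  ultimately show ?thesis by simp
qed simp

section \<open>Arcs with nondecreasing curvature\<close>

locale increasing_arc =
  fixes L :: real and z :: "real \<Rightarrow> complex" and \<theta> k :: "real \<Rightarrow> real"
  assumes arc: "arc_with_curvature L z \<theta> k"
    and mono: "mono_on {0..L} k"
begin

lemma L_pos: "0 < L"
  using arc by (simp add: arc_with_curvature_def)

lemma k_mono: "0 \<le> s \<Longrightarrow> s \<le> t \<Longrightarrow> t \<le> L \<Longrightarrow> k s \<le> k t"
  using mono by (auto simp: mono_on_def)

lemma k_has_integral_from_0: "s \<in> {0..L} \<Longrightarrow> (k has_integral (\<theta> s - \<theta> 0)) {0..s}"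
  using arc by (simp add: arc_with_curvature_def)

lemma k_integrable: "k integrable_on {0..L}"
  using k_has_integral_from_0[of L] L_pos by (auto simp: integrable_on_def)

lemma \<theta>_eq_integral: "s \<in> {0..L} \<Longrightarrow> \<theta> s = \<theta> 0 + integral {0..s} k"
  using k_has_integral_from_0[of s] by (simp add: integral_unique)

lemma continuous_\<theta>: "continuous_on {0..L} \<theta>"
proof -
  have "continuous_on {0..L} (\<lambda>s. \<theta> 0 + integral {0..s} k)"
    by (intro continuous_intros indefinite_integral_continuous_1 k_integrable)
  then show ?thesis
    by (rule continuous_on_eq) (simp flip: \<theta>_eq_integral)
qed

lemma k_has_integral:
  assumes "0 \<le> s" "s \<le> t" "t \<le> L"
  shows "(k has_integral (\<theta> t - \<theta> s)) {s..t}"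
proof -
  have "k integrable_on {s..t}"
    by (rule integrable_on_subinterval[OF k_integrable]) (use assms in auto)
  moreover have "integral {0..s} k + integral {s..t} k = integral {0..t} k"
    by (rule Henstock_Kurzweil_Integration.integral_combine
        [OF _ _ integrable_on_subinterval[OF k_integrable]]) (use assms in auto)
  ultimately show ?thesis
    using assms \<theta>_eq_integral[of s] \<theta>_eq_integral[of t] by (simp add: has_integral_iff)
qed

lemma \<theta>_increment_bounds:
  assumes "0 \<le> s" "s \<le> t" "t \<le> L"
  shows "k s * (t - s) \<le> \<theta> t - \<theta> s" "\<theta> t - \<theta> s \<le> k t * (t - s)"
proof -
  have const: "((\<lambda>_. c) has_integral c * (t - s)) {s..t}" for c :: real
    using has_integral_const_real[of c s t] assms by (simp add: mult.commute)
  show "k s * (t - s) \<le> \<theta> t - \<theta> s"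
    by (rule has_integral_le[OF const k_has_integral]) (use assms k_mono in auto)
  show "\<theta> t - \<theta> s \<le> k t * (t - s)"
    by (rule has_integral_le[OF k_has_integral const]) (use assms k_mono in auto)
qed

lemma \<theta>_derivative:
  assumes "s \<in> {0..L}" and "continuous (at s within {0..L}) k"
  shows "(\<theta> has_real_derivative k s) (at s within {0..L})"
proof -
  have "((\<lambda>u. integral {0..u} k) has_vector_derivative k s) (at s within ({0..L} - {}))"
    by (rule integral_has_vector_derivative_continuous_at) (use assms k_integrable in auto)
  then have "((\<lambda>u. \<theta> 0 + integral {0..u} k) has_real_derivative k s) (at s within {0..L})"
    by (auto simp: has_real_derivative_iff_has_vector_derivative intro!: derivative_eq_intros)
  then show ?thesis
    by (rule has_field_derivative_transform_within[of _ _ _ _ 1])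
       (use assms in \<open>auto simp flip: \<theta>_eq_integral\<close>)
qed

lemma z_derivative:
  "s \<in> {0..L} \<Longrightarrow> (z has_vector_derivative cis (\<theta> s)) (at s within {0..L})"
  using arc by (simp add: arc_with_curvature_def)

lemma continuous_z: "continuous_on {0..L} z"
  unfolding continuous_on_eq_continuous_within
  using z_derivative has_vector_derivative_continuous by blast

text \<open>
  A fundamental theorem of calculus for \<open>G\<close> whose derivative is computed from \<open>\<theta>' = k\<close>. That
  equation is only known where \<open>k\<close> is continuous, but the monotone function \<open>k\<close> has at most countably
  many discontinuities, and these do not affect the conclusion that \<open>G\<close> minus the integral is
  constant.
\<close>
lemma has_integral_k_times:
  assumes v: "continuous_on {0..L} v" and G: "continuous_on {0..L} G"
    and G_deriv: "\<And>x. x \<in> {0..L} \<Longrightarrow> (\<theta> has_real_derivative k x) (at x within {0..L})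
      \<Longrightarrow> (G has_real_derivative k x * v x) (at x within {0..L})"
    and st: "0 \<le> s" "s \<le> t" "t \<le> L"
  shows "((\<lambda>x. k x * v x) has_integral (G t - G s)) {s..t}"
proof -
  define S where "S = {x \<in> {0..L}. \<not> continuous (at x within {0..L}) k}"
  have S: "countable S"
    unfolding S_def by (rule mono_on_ctble_discont[OF mono])
  have sub: "{s..t} \<subseteq> {0..L}" using st by auto
  have "v integrable_on {s..t}"
    by (rule integrable_continuous_real[OF continuous_on_subset[OF v sub]])
  then have int: "(\<lambda>x. k x * v x) integrable_on {s..t}"
  proof (rule second_mean_value_theorem_full[OF _ st(2), where g = k])
    show "k x \<le> k y" if "s \<le> x" "x \<le> y" "y \<le> t" for x y
      using k_mono[of x y] that st by simp
  qed auto
  define D where "D = (\<lambda>x. G x - integral {s..x} (\<lambda>x. k x * v x))"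
  have "D t = D s"
  proof (rule constant_if_derivative_zero_off_countable[OF st(2) S])
    show "continuous_on {s..t} D"
      unfolding D_def
      by (intro continuous_intros continuous_on_subset[OF G sub] indefinite_integral_continuous_1 int)
    fix x assume x: "x \<in> {s..t} - S"
    then have x0: "x \<in> {0..L}" and cont: "continuous (at x within {0..L}) k"
      using sub by (auto simp: S_def)
    have "(G has_real_derivative k x * v x) (at x within {s..t})"
      by (rule has_field_derivative_subset[OF G_deriv[OF x0 \<theta>_derivative[OF x0 cont]] sub])
    moreover have "continuous (at x within {s..t}) (\<lambda>x. k x * v x)"
      by (rule continuous_within_subset[OF _ sub])
         (use v x0 cont in \<open>auto intro!: continuous_intros simp: continuous_on_eq_continuous_within\<close>)
    then have "((\<lambda>u. integral {s..u} (\<lambda>x. k x * v x)) has_real_derivative k x * v x)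
        (at x within {s..t})"
      using integral_has_vector_derivative_continuous_at[OF int, of x "{}"] x
      by (simp add: has_real_derivative_iff_has_vector_derivative)
    ultimately have "(D has_real_derivative k x * v x - k x * v x) (at x within {s..t})"
      unfolding D_def by (rule DERIV_diff)
    then show "(D has_real_derivative 0) (at x within {s..t})"
      by simp
  qed
  then show ?thesis
    using int by (simp add: D_def has_integral_iff)
qed

text \<open>
  The power of the point \<open>p\<close> with respect to the circle of curvature at \<open>s\<close>, multiplied by the
  curvature. In this scaling it stays meaningful for curvature 0, and it is negative exactly when
  \<open>p\<close> lies to the left of the oriented circle.
\<close>
definition osculating_power :: "complex \<Rightarrow> real \<Rightarrow> real" where
  "osculating_power p s = k s * (cmod (p - z s))\<^sup>2
     + 2 * ((Re p - Re (z s)) * sin (\<theta> s) - (Im p - Im (z s)) * cos (\<theta> s))"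

text \<open>
  This is the mean-value form of the identity \<open>dC = q dk\<close> with \<open>C\<close> the osculating power and
  \<open>q = (norm (p - z))\<^sup>2\<close>. Writing \<open>C = k * q + g\<close>, a computation gives \<open>g' = - k * q'\<close>, so the second
  mean value theorem for the integral of the product of the monotone \<open>k\<close> and \<open>q'\<close> replaces the
  Stieltjes integral of \<open>q\<close> with respect to \<open>k\<close>.
\<close>
lemma osculating_power_increment:
  assumes "0 \<le> s" "s \<le> t" "t \<le> L"
  obtains c where "c \<in> {s..t}"
    "osculating_power p t - osculating_power p s = (k t - k s) * (cmod (p - z c))\<^sup>2"
proof -
  define q where "q = (\<lambda>u. (Re p - Re (z u))\<^sup>2 + (Im p - Im (z u))\<^sup>2)"
  \<comment> \<open>\<open>w = - q'\<close> and \<open>g' = k * w\<close>.\<close>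
  define w where "w = (\<lambda>u. 2 * ((Re p - Re (z u)) * cos (\<theta> u) + (Im p - Im (z u)) * sin (\<theta> u)))"
  define g where "g = (\<lambda>u. 2 * ((Re p - Re (z u)) * sin (\<theta> u) - (Im p - Im (z u)) * cos (\<theta> u)))"
  have q: "(cmod (p - z u))\<^sup>2 = q u" for u
    by (simp add: cmod_power2 q_def)
  have sub: "{s..t} \<subseteq> {0..L}" using assms by auto
  have w_cont: "continuous_on {0..L} w" and g_cont: "continuous_on {0..L} g"
    unfolding w_def g_def by (intro continuous_intros continuous_z continuous_\<theta>)+
  have q_deriv: "(q has_real_derivative - w u) (at u within {0..L})" if "u \<in> {0..L}" for u
    unfolding q_def w_def
    by (auto intro!: derivative_eq_intros z_derivative that simp: algebra_simps)
  have g_int: "((\<lambda>u. k u * w u) has_integral (g t - g s)) {s..t}"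
  proof (rule has_integral_k_times[OF w_cont g_cont _ assms])
    fix u assume u: "u \<in> {0..L}" and "(\<theta> has_real_derivative k u) (at u within {0..L})"
    note d = this(2)
    show "(g has_real_derivative k u * w u) (at u within {0..L})"
      unfolding g_def w_def
      by (auto intro!: derivative_eq_intros z_derivative u d simp: algebra_simps)
  qed
  have q_int: "integral {a..b} w = q a - q b" if "s \<le> a" "a \<le> b" "b \<le> t" for a b
  proof -
    have "((\<lambda>u. - w u) has_integral (q b - q a)) {a..b}"
      using that assms
      by (intro fundamental_theorem_of_calculus)
         (auto simp: has_real_derivative_iff_has_vector_derivative[symmetric]
               intro!: has_field_derivative_subset[OF q_deriv])
    from has_integral_neg[OF this] show ?thesis
      by (auto intro!: integral_unique)
  qed
  have "w integrable_on {s..t}"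
    by (rule integrable_continuous_real[OF continuous_on_subset[OF w_cont sub]])
  then obtain c where c: "c \<in> {s..t}"
    "((\<lambda>u. k u * w u) has_integral (k s * integral {s..c} w + k t * integral {c..t} w)) {s..t}"
  proof (rule second_mean_value_theorem_full[OF _ assms(2), where g = k])
    show "k x \<le> k y" if "s \<le> x" "x \<le> y" "y \<le> t" for x y
      using k_mono[of x y] that assms by simp
  qed
  have "g t - g s = k s * (q s - q c) + k t * (q c - q t)"
    using has_integral_unique[OF g_int c(2)] c(1) assms by (simp add: q_int)
  then have "osculating_power p t - osculating_power p s = (k t - k s) * q c"
    by (simp add: osculating_power_def q g_def algebra_simps)
  then show ?thesis
    using that c(1) by (simp add: q)
qed

end
lemma cis_affine_antiderivative:
  assumes "\<kappa> \<noteq> 0"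
  shows "((\<lambda>s. cis (a + \<kappa> * s) / (\<i> * of_real \<kappa>)) has_vector_derivative cis (a + \<kappa> * s)) (at s within S)"
  unfolding has_vector_derivative_def
  using assms
  by (auto intro!: derivative_eq_intros simp: fun_eq_iff scaleR_conv_of_real field_simps)

context increasing_arc begin

lemma osculating_power_mono:
  assumes "0 \<le> s" "s \<le> t" "t \<le> L"
  shows "osculating_power p s \<le> osculating_power p t"
proof -
  obtain c where "osculating_power p t - osculating_power p s = (k t - k s) * (cmod (p - z c))\<^sup>2"
    using osculating_power_increment[OF assms] by metis
  moreover have "0 \<le> k t - k s" using k_mono assms by simp
  ultimately show ?thesis
    by (metis diff_ge_0_iff_ge mult_nonneg_nonneg zero_le_power2)
qed

text \<open>
  The power of \<open>p\<close> is monotone, hence 0 throughout; an increment \<open>(k y - k x) * (norm (p - z c))\<^sup>2\<close>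
  can then vanish only if \<open>k x = k y\<close>.
\<close>
lemma k_constant_between_returns:
  assumes uv: "0 \<le> u" "u < v" "v \<le> L"
    and ends: "osculating_power p u = 0" "osculating_power p v = 0"
    and avoid: "\<And>x. u < x \<Longrightarrow> x < v \<Longrightarrow> z x \<noteq> p"
    and xy: "u < x" "x \<le> y" "y < v"
  shows "k x = k y"
proof -
  have zero: "osculating_power p w = 0" if "u \<le> w" "w \<le> v" for w
    using osculating_power_mono[of u w p] osculating_power_mono[of w v p] that uv ends by simp
  have "0 \<le> x" "y \<le> L" using uv xy by auto
  then obtain c where c: "c \<in> {x..y}"
    "osculating_power p y - osculating_power p x = (k y - k x) * (cmod (p - z c))\<^sup>2"
    using osculating_power_increment xy by metis
  then have "(k y - k x) * (cmod (p - z c))\<^sup>2 = 0"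
    using zero xy by simp
  then show ?thesis
    using avoid[of c] c(1) xy by auto
qed

text \<open>
  With constant curvature, \<open>\<theta>\<close> is affine and \<open>z\<close> is given explicitly. The loop closes only if the
  tangent directions at \<open>u\<close> and \<open>v\<close> agree, and \<open>\<kappa> = 0\<close> is impossible because a segment does not close.
\<close>
lemma full_turn_if_closed_circle:
  assumes uv: "0 \<le> u" "u < v" "v \<le> L" and closed: "z u = z v"
    and const: "\<And>x. u < x \<Longrightarrow> x < v \<Longrightarrow> k x = \<kappa>"
  shows "2 * pi \<le> \<bar>\<theta> v - \<theta> u\<bar>"
proof -
  have \<theta>: "\<theta> y = \<theta> u + \<kappa> * (y - u)" if y: "u \<le> y" "y \<le> v" for y
  proof -
    have "((\<lambda>_. \<kappa>) has_integral \<kappa> * (y - u)) {u..y}"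
      using has_integral_const_real[of \<kappa> u y] y by (simp add: mult.commute)
    then have "(k has_integral \<kappa> * (y - u)) {u..y}"
      by (rule has_integral_spike_finite[of "{u, y}", rotated 2]) (use const y in auto)
    from has_integral_unique[OF k_has_integral this] show ?thesis
      using y uv by simp
  qed
  have z_int: "((\<lambda>y. cis (\<theta> y)) has_integral 0) {u..v}"
  proof -
    have "(z has_vector_derivative cis (\<theta> y)) (at y within {u..v})" if "y \<in> {u..v}" for y
      by (rule has_vector_derivative_within_subset[OF z_derivative]) (use that uv in auto)
    from fundamental_theorem_of_calculus[OF _ this] show ?thesis
      using uv closed by simp
  qed
  have z_int': "((\<lambda>y. cis (\<theta> u + \<kappa> * (y - u))) has_integral 0) {u..v}"
  proof (rule has_integral_eq[OF _ z_int])
    show "cis (\<theta> y) = cis (\<theta> u + \<kappa> * (y - u))" if "y \<in> {u..v}" for y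
      by (subst \<theta>) (use that in auto)
  qed
  have "\<kappa> \<noteq> 0"
  proof
    assume "\<kappa> = 0"
    then have "((\<lambda>_. cis (\<theta> u)) has_integral 0) {u..v}"
      using z_int' by simp
    moreover have "((\<lambda>_. cis (\<theta> u)) has_integral (v - u) *\<^sub>R cis (\<theta> u)) {u..v}"
      using has_integral_const_real[of "cis (\<theta> u)" u v] uv by simp
    ultimately have "(v - u) *\<^sub>R cis (\<theta> u) = 0"
      using has_integral_unique by blast
    then show False
      using uv by simp
  qed
  define G where "G = (\<lambda>y. cis (\<theta> u + \<kappa> * (y - u)) / (\<i> * complex_of_real \<kappa>))"
  have "(G has_vector_derivative cis (\<theta> u + \<kappa> * (y - u))) (at y within {u..v})" for y
    using cis_affine_antiderivative[OF \<open>\<kappa> \<noteq> 0\<close>, of "\<theta> u - \<kappa> * u" y "{u..v}"]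
    by (simp add: G_def algebra_simps)
  then have "((\<lambda>y. cis (\<theta> u + \<kappa> * (y - u))) has_integral (G v - G u)) {u..v}"
    using uv by (intro fundamental_theorem_of_calculus) auto
  then have "G v - G u = 0"
    by (rule has_integral_unique) (rule z_int')
  then have "cis (\<theta> v) = cis (\<theta> u)"
    using \<open>\<kappa> \<noteq> 0\<close> \<theta>[of v] uv by (simp add: G_def)
  then obtain n :: int where n: "\<theta> v = \<theta> u + 2 * pi * n"
    using sin_cos_eq_iff[of "\<theta> v" "\<theta> u"] by (auto simp: cis.ctr complex_eq_iff)
  have "\<theta> v \<noteq> \<theta> u"
    using \<theta>[of v] \<open>\<kappa> \<noteq> 0\<close> uv by simp
  then have "1 \<le> \<bar>real_of_int n\<bar>"
    using n by (auto simp flip: of_int_abs)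
  then show ?thesis
    using n by (simp add: abs_mult)
qed

end

section \<open>Short spirals with increasing curvature\<close>

locale short_increasing_spiral = increasing_arc +
  assumes not_constant: "\<not> k constant_on {0..L}"
    and ends_distinct: "z 0 \<noteq> z L"
    and chord_horizontal: "Im (z 0) = Im (z L)"
    and \<theta>_bounds: "\<And>s. 0 < s \<Longrightarrow> s < L \<Longrightarrow> -pi < \<theta> s \<and> \<theta> s < pi"
begin

text \<open>
  Nonconstancy on the closed interval could come from the two boundary values alone, if \<open>k\<close> were
  not continuous there; with the continuity at the ends, \<open>k\<close> really increases inside the arc.
\<close>
lemma k_increases_inside:
  obtains s t where "0 < s" "s < t" "t < L" "k s < k t"
proof -
  have "k 0 < k L"
  proof (rule ccontr)
    assume "\<not> k 0 < k L"
    then have "k s = k 0" if "s \<in> {0..L}" for s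
      using k_mono[of 0 s] k_mono[of s L] that by auto
    then show False using not_constant unfolding constant_on_def by blast
  qed
  define e where "e = (k L - k 0) / 2"
  have "e > 0" using \<open>k 0 < k L\<close> by (simp add: e_def)
  have "continuous (at 0 within {0..L}) k" "continuous (at L within {0..L}) k"
    using arc by (auto simp: arc_with_curvature_def)
  then have "\<exists>d>0. \<forall>x\<in>{0..L}. dist x 0 < d \<longrightarrow> dist (k x) (k 0) < e"
    "\<exists>d>0. \<forall>x\<in>{0..L}. dist x L < d \<longrightarrow> dist (k x) (k L) < e"
    using \<open>e > 0\<close> unfolding continuous_within_eps_delta by blast+
  then obtain d1 d2 where d: "d1 > 0" "d2 > 0"
    "\<And>x. x \<in> {0..L} \<Longrightarrow> \<bar>x\<bar> < d1 \<Longrightarrow> \<bar>k x - k 0\<bar> < e"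
    "\<And>x. x \<in> {0..L} \<Longrightarrow> \<bar>x - L\<bar> < d2 \<Longrightarrow> \<bar>k x - k L\<bar> < e"
    by (auto simp: dist_real_def)
  define s where "s = min (d1 / 2) (L / 3)"
  define t where "t = L - min (d2 / 2) (L / 3)"
  have st: "0 < s" "s < d1" "s \<le> L / 3" "t < L" "L - t < d2" "L - L / 3 \<le> t"
    using d(1,2) L_pos by (simp_all add: s_def t_def min_less_iff_disj)
  have "s < t" using st L_pos by linarith
  have "\<bar>k s - k 0\<bar> < e" "\<bar>k t - k L\<bar> < e"
    using d(3)[of s] d(4)[of t] st \<open>s < t\<close> by auto
  then have "k s < k 0 + e" "k L - e < k t" by linarith+
  then have "k s < k t" by (simp add: e_def field_simps)
  then show ?thesis using that st \<open>s < t\<close> by blast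
qed

lemma \<theta>_bounds_closed:
  assumes "s \<in> {0..L}"
  shows "-pi \<le> \<theta> s" "\<theta> s \<le> pi"
proof -
  have cl: "closure {0<..<L} = {0..L}"
    using L_pos by simp
  show "-pi \<le> \<theta> s" "\<theta> s \<le> pi"
    using continuous_ge_on_closure[of "{0<..<L}" \<theta> s "-pi"]
      continuous_le_on_closure[of "{0<..<L}" \<theta> s pi] continuous_\<theta> assms \<theta>_bounds
    unfolding cl by (auto simp: less_imp_le)
qed

text \<open>
  Suppose that the arc returns to \<open>p\<close>. Pick a point of the loop off \<open>p\<close>, and the last visit \<open>u\<close>
  and the first visit \<open>v\<close> of \<open>p\<close> around it. The curvature is constant between \<open>u\<close> and \<open>v\<close>, so
  \<open>\<theta>\<close> changes by at least \<open>2 * pi\<close>. But \<open>\<theta>\<close> stays within \<open>{-pi..pi}\<close>, and strictly so at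
  interior points, and \<open>u\<close> and \<open>v\<close> are not both ends of the arc because these are distinct.
\<close>
lemma z_injective:
  assumes st: "0 \<le> s" "s < t" "t \<le> L"
  shows "z s \<noteq> z t"
proof
  assume eq: "z s = z t"
  define p where "p = z s"
  then have zp: "z s = p" "z t = p" using eq by simp_all
  have sub: "{s..t} \<subseteq> {0..L}" using st by auto
  have "\<exists>x. s < x \<and> x < t \<and> z x \<noteq> p"
  proof (rule ccontr)
    assume "\<nexists>x. s < x \<and> x < t \<and> z x \<noteq> p"
    then have const: "z y = p" if "y \<in> {s..t}" for y
      using that zp by (metis atLeastAtMost_iff less_eq_real_def)
    have "(z has_vector_derivative cis (\<theta> s)) (at s within {s..t})"
      by (rule has_vector_derivative_within_subset[OF z_derivative sub]) (use st in auto)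
    moreover have "(z has_vector_derivative 0) (at s within {s..t})"
      by (rule has_vector_derivative_transform[OF _ const has_vector_derivative_const]) (use st in auto)
    ultimately have "cis (\<theta> s) = 0"
      by (intro vector_derivative_unique_within_closed_interval[of s t s z]) (use st in auto)
    then show False by simp
  qed
  then obtain x where x: "s < x" "x < t" "z x \<noteq> p" by blast
  have closed: "compact ({a..b} \<inter> z -` {p})" if "s \<le> a" "b \<le> t" for a b
  proof -
    have "closed ({a..b} \<inter> z -` {p})"
      by (rule continuous_closed_preimage[OF continuous_on_subset[OF continuous_z]])
         (use that st in auto)
    then show ?thesis
      by (metis compact_Icc compact_Int_closed inf.absorb_iff2 inf_le1)
  qed
  have "s \<in> {s..x} \<inter> z -` {p}" "t \<in> {x..t} \<inter> z -` {p}"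
    using x zp by auto
  then have nonempty: "{s..x} \<inter> z -` {p} \<noteq> {}" "{x..t} \<inter> z -` {p} \<noteq> {}" by blast+
  obtain u where u: "u \<in> {s..x} \<inter> z -` {p}" "\<And>y. y \<in> {s..x} \<inter> z -` {p} \<Longrightarrow> y \<le> u"
    using compact_attains_sup[OF closed nonempty(1)] x by auto
  obtain v where v: "v \<in> {x..t} \<inter> z -` {p}" "\<And>y. y \<in> {x..t} \<inter> z -` {p} \<Longrightarrow> v \<le> y"
    using compact_attains_inf[OF closed nonempty(2)] x by auto
  have uv: "s \<le> u" "u < x" "x < v" "v \<le> t" "z u = p" "z v = p"
    using u(1) v(1) x by (auto simp: order_less_le)
  have avoid: "z y \<noteq> p" if y: "u < y" "y < v" for y
  proof
    assume "z y = p"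
    then show False
      using u(2)[of y] v(2)[of y] y uv by (cases "y \<le> x") simp_all
  qed
  have power_zero: "osculating_power p u = 0" "osculating_power p v = 0"
    using uv by (simp_all add: osculating_power_def)
  have uv': "0 \<le> u" "u < v" "v \<le> L" "z u = z v" using uv st by simp_all
  have const: "k y = k y'" if "u < y" "y \<le> y'" "y' < v" for y y'
    by (intro k_constant_between_returns[OF uv'(1-3) power_zero avoid] that)
  have k_eq: "k y = k x" if "u < y" "y < v" for y
  proof (cases "y \<le> x")
    case True
    show ?thesis by (rule const[OF that(1) True uv(3)])
  next
    case False
    then have "x \<le> y" by simp
    from const[OF uv(2) this that(2)] show ?thesis by (rule sym)
  qed
  have "2 * pi \<le> \<bar>\<theta> v - \<theta> u\<bar>"
    by (rule full_turn_if_closed_circle[OF uv' k_eq])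
  moreover have "\<bar>\<theta> v - \<theta> u\<bar> < 2 * pi"
  proof (cases "u = 0")
    case False
    then show ?thesis
      using \<theta>_bounds[of u] \<theta>_bounds_closed[of v] uv st by auto
  next
    case True
    then have "v < L"
      using ends_distinct uv st eq by (auto simp: less_le)
    then show ?thesis
      using \<theta>_bounds[of v] \<theta>_bounds_closed[of u] uv st by auto
  qed
  ultimately show False by simp
qed

lemma osculating_power_strict_increase:
  assumes "p = z 0 \<or> p = z L"
  shows "osculating_power p 0 < osculating_power p L"
proof -
  obtain s t where st: "0 < s" "s < t" "t < L" "k s < k t"
    by (rule k_increases_inside)
  then obtain c where c: "c \<in> {s..t}"
    "osculating_power p t - osculating_power p s = (k t - k s) * (cmod (p - z c))\<^sup>2"
    using osculating_power_increment[of s t p] by auto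
  have "z c \<noteq> p"
    using assms z_injective[of 0 c] z_injective[of c L] c st by auto
  then have "0 < (k t - k s) * (cmod (p - z c))\<^sup>2"
    using st by simp
  then show ?thesis
    using osculating_power_mono[of 0 s p] osculating_power_mono[of t L p] c st by simp
qed

lemma sin_\<theta>_integral: "((\<lambda>s. sin (\<theta> s)) has_integral 0) {0..L}"
proof -
  have "((\<lambda>s. cis (\<theta> s)) has_integral (z L - z 0)) {0..L}"
    by (rule fundamental_theorem_of_calculus) (use L_pos z_derivative in auto)
  from has_integral_Im[OF this] show ?thesis
    using chord_horizontal by simp
qed

lemma k_sin_\<theta>_integral: "((\<lambda>s. k s * sin (\<theta> s)) has_integral (cos (\<theta> 0) - cos (\<theta> L))) {0..L}"
proof -
  have "((\<lambda>s. k s * sin (\<theta> s)) has_integral (- cos (\<theta> L) - (- cos (\<theta> 0)))) {0..L}"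
  proof (rule has_integral_k_times)
    show "((\<lambda>s. - cos (\<theta> s)) has_real_derivative k x * sin (\<theta> x)) (at x within {0..L})"
      if "(\<theta> has_real_derivative k x) (at x within {0..L})" for x
      by (auto intro!: derivative_eq_intros that)
  qed (use L_pos in \<open>auto intro!: continuous_intros continuous_\<theta>\<close>)
  then show ?thesis by simp
qed

text \<open>
  Otherwise the convex function \<open>\<theta>\<close> is nonpositive, so \<open>sin \<theta>\<close> is too; its integral being 0, \<open>\<theta>\<close>
  vanishes identically and the curvature is constantly 0.
\<close>
lemma not_both_ends_nonpos: "0 < \<theta> 0 \<or> 0 < \<theta> L"
proof (rule ccontr)
  assume "\<not> ?thesis"
  then have ends: "\<theta> 0 \<le> 0" "\<theta> L \<le> 0" by auto
  have nonpos: "\<theta> s \<le> 0" if s: "s \<in> {0<..<L}" for s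
  proof (rule ccontr)
    assume "\<not> \<theta> s \<le> 0"
    then have "0 < k s * s"
      using \<theta>_increment_bounds(2)[of 0 s] s ends by simp
    then have "0 < k s" using s by (simp add: zero_less_mult_iff)
    then have "0 < k s * (L - s)" using s by simp
    then show False
      using \<theta>_increment_bounds(1)[of s L] s ends \<open>\<not> \<theta> s \<le> 0\<close> by simp
  qed
  have zero: "\<theta> s = 0" if s: "s \<in> {0<..<L}" for s
  proof (rule ccontr)
    assume "\<theta> s \<noteq> 0"
    have sin_le: "0 \<le> - sin (\<theta> u)" if "u \<in> {0..L}" for u
      using sin_ge_zero[of "- \<theta> u"] \<theta>_bounds_closed[of u] nonpos[of u] ends that
      by (cases "u = 0"; cases "u = L") auto
    have "((\<lambda>u. - sin (\<theta> u)) has_integral 0) {0..L}"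
      using has_integral_neg[OF sin_\<theta>_integral] by simp
    moreover have "continuous_on {0..L} (\<lambda>u. - sin (\<theta> u))"
      by (intro continuous_intros continuous_\<theta>)
    ultimately have "- sin (\<theta> s) = 0"
      using has_integral_0_cbox_imp_0[of 0 L "\<lambda>u. - sin (\<theta> u)" s] sin_le s by auto
    then show False
      using sin_gt_zero[of "- \<theta> s"] \<theta>_bounds[of s] nonpos[OF s] s \<open>\<theta> s \<noteq> 0\<close> by auto
  qed
  obtain s t where st: "0 < s" "s < t" "t < L" "k s < k t"
    by (rule k_increases_inside)
  \<comment> \<open>The slopes of \<open>\<theta>\<close> on the two sides of \<open>u\<close> enclose \<open>k u\<close>.\<close>
  have *: "k u = 0" if "0 < u" "u < L" for u
  proof -
    define a b where "a = u / 2" and "b = (u + L) / 2"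
    have ab: "0 < a" "a < u" "u < b" "b < L" using that by (auto simp: a_def b_def)
    have "k u * (b - u) \<le> 0" "0 \<le> k u * (u - a)"
      using \<theta>_increment_bounds(1)[of u b] \<theta>_increment_bounds(2)[of a u] zero ab that by auto
    then show ?thesis using ab by (simp add: mult_le_0_iff zero_le_mult_iff)
  qed
  show False using *[of s] *[of t] st by simp
qed

text \<open>
  A convex function with boundary values of opposite signs vanishes exactly once. Convexity enters
  through the slope bounds \<open>\<theta>_increment_bounds\<close>.
\<close>
lemma sign_change:
  assumes "\<theta> 0 * \<theta> L < 0"
  defines "\<epsilon> \<equiv> sgn (\<theta> 0)"
  obtains s1 where "0 < s1" "s1 < L"
    "\<And>s. 0 < s \<Longrightarrow> s < s1 \<Longrightarrow> 0 < \<epsilon> * sin (\<theta> s)"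
    "\<And>s. s1 < s \<Longrightarrow> s < L \<Longrightarrow> \<epsilon> * sin (\<theta> s) < 0"
proof -
  have "\<exists>s. 0 \<le> s \<and> s \<le> L \<and> \<theta> s = 0"
  proof (cases "\<theta> 0 < 0")
    case True
    then show ?thesis
      using IVT'[of \<theta> 0 0 L] assms L_pos continuous_\<theta> by (auto simp: mult_less_0_iff)
  next
    case False
    then show ?thesis
      using IVT2'[of \<theta> L 0 0] assms L_pos continuous_\<theta> by (auto simp: mult_less_0_iff)
  qed
  then obtain s1 where s1: "0 \<le> s1" "s1 \<le> L" "\<theta> s1 = 0" by blast
  then have s1': "0 < s1" "s1 < L" using assms by (auto simp: less_le)
  have signs: "(0 < s \<and> s < s1 \<longrightarrow> 0 < \<epsilon> * \<theta> s) \<and> (s1 < s \<and> s < L \<longrightarrow> \<epsilon> * \<theta> s < 0)" for s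
  proof (cases "0 < \<theta> 0")
    case True
    then have "\<theta> L < 0" using assms by (simp add: mult_less_0_iff)
    have "k s1 * (L - s1) < 0"
      using \<theta>_increment_bounds(1)[of s1 L] s1 \<open>\<theta> L < 0\<close> by simp
    then have "k s1 < 0" using s1' by (simp add: mult_less_0_iff)
    have "0 < \<theta> s" if "0 < s" "s < s1"
    proof -
      have "k s1 * (s1 - s) < 0" using \<open>k s1 < 0\<close> that by (simp add: mult_less_0_iff)
      then show ?thesis using \<theta>_increment_bounds(2)[of s s1] s1 that by simp
    qed
    moreover have "\<theta> s < 0" if "s1 < s" "s < L"
    proof (rule ccontr)
      assume "\<not> \<theta> s < 0"
      then have "0 \<le> k s * (s - s1)" using \<theta>_increment_bounds(2)[of s1 s] s1 that by simp
      then have "0 \<le> k s * (L - s)" using that by (simp add: zero_le_mult_iff)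
      then show False
        using \<theta>_increment_bounds(1)[of s L] s1 that \<open>\<not> \<theta> s < 0\<close> \<open>\<theta> L < 0\<close> by simp
    qed
    ultimately show ?thesis using True by (simp add: \<epsilon>_def)
  next
    case False
    then have "\<theta> 0 < 0" "0 < \<theta> L" using assms by (auto simp: mult_less_0_iff)
    have "0 < k s1 * s1"
      using \<theta>_increment_bounds(2)[of 0 s1] s1 \<open>\<theta> 0 < 0\<close> by simp
    then have "0 < k s1" using s1' by (simp add: zero_less_mult_iff)
    have "0 < \<theta> s" if "s1 < s" "s < L"
    proof -
      have "0 < k s1 * (s - s1)" using \<open>0 < k s1\<close> that by simp
      then show ?thesis using \<theta>_increment_bounds(1)[of s1 s] s1 that by simp
    qed
    moreover have "\<theta> s < 0" if "0 < s" "s < s1"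
    proof (rule ccontr)
      assume "\<not> \<theta> s < 0"
      then have "0 < k s * s" using \<theta>_increment_bounds(2)[of 0 s] s1 that \<open>\<theta> 0 < 0\<close> by simp
      then have "0 < k s * (s1 - s)" using that by (simp add: zero_less_mult_iff)
      then show False
        using \<theta>_increment_bounds(1)[of s s1] s1 that \<open>\<not> \<theta> s < 0\<close> by simp
    qed
    ultimately show ?thesis using \<open>\<theta> 0 < 0\<close> by (simp add: \<epsilon>_def)
  qed
  have \<epsilon>: "\<epsilon> = 1 \<or> \<epsilon> = -1"
    using assms by (auto simp: \<epsilon>_def sgn_if)
  have sin_pos: "0 < \<epsilon> * sin (\<theta> s)" if "0 < s" "s < s1" for s
    using signs[of s] that s1' \<theta>_bounds[of s] \<epsilon> sin_gt_zero[of "\<theta> s"] sin_gt_zero[of "- \<theta> s"] by auto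
  have sin_neg: "\<epsilon> * sin (\<theta> s) < 0" if "s1 < s" "s < L" for s
    using signs[of s] that s1' \<theta>_bounds[of s] \<epsilon> sin_gt_zero[of "\<theta> s"] sin_gt_zero[of "- \<theta> s"] by auto
  show ?thesis using that[OF s1' sin_pos sin_neg] by blast
qed

text \<open>
  The number \<open>sgn (\<theta> 0) * (cos (\<theta> 0) - cos (\<theta> L))\<close> is the integral of
  \<open>sgn (\<theta> 0) * (k - c) * sin \<theta>\<close> for every constant \<open>c\<close>, since \<open>sin \<theta>\<close> has integral 0. With
  \<open>c = k s1\<close>, where \<open>s1\<close> is the zero of \<open>\<theta>\<close>, the integrand is nonpositive: at \<open>s1\<close> the factor
  \<open>k - c\<close> passes from nonpositive to nonnegative and \<open>sgn (\<theta> 0) * sin \<theta>\<close> from positive to negative.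
\<close>
lemma cos_ends_strict:
  assumes "\<theta> 0 * \<theta> L < 0"
  shows "sgn (\<theta> 0) * (cos (\<theta> 0) - cos (\<theta> L)) < 0"
proof -
  define \<epsilon> where "\<epsilon> = sgn (\<theta> 0)"
  obtain s1 where s1: "0 < s1" "s1 < L"
    and pos: "\<And>s. 0 < s \<Longrightarrow> s < s1 \<Longrightarrow> 0 < \<epsilon> * sin (\<theta> s)"
    and neg: "\<And>s. s1 < s \<Longrightarrow> s < L \<Longrightarrow> \<epsilon> * sin (\<theta> s) < 0"
    using sign_change[OF assms] unfolding \<epsilon>_def by blast
  define h where "h = (\<lambda>c s. (k s - c) * (\<epsilon> * sin (\<theta> s)))"
  have h_int: "(h c has_integral \<epsilon> * (cos (\<theta> 0) - cos (\<theta> L))) {0..L}" for c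
  proof -
    have "((\<lambda>s. \<epsilon> * (k s * sin (\<theta> s) - c * sin (\<theta> s))) has_integral
        \<epsilon> * ((cos (\<theta> 0) - cos (\<theta> L)) - c * 0)) {0..L}"
      by (intro has_integral_mult_right has_integral_diff k_sin_\<theta>_integral sin_\<theta>_integral)
    then show ?thesis by (simp add: h_def algebra_simps)
  qed
  have ends: "0 \<le> \<epsilon> * sin (\<theta> 0)" "\<epsilon> * sin (\<theta> L) \<le> 0"
    using assms \<theta>_bounds_closed[of 0] \<theta>_bounds_closed[of L] L_pos
      sin_ge_zero[of "\<theta> 0"] sin_ge_zero[of "- \<theta> 0"] sin_ge_zero[of "\<theta> L"] sin_ge_zero[of "- \<theta> L"]
    by (auto simp: \<epsilon>_def mult_less_0_iff)
  have nonneg: "0 \<le> \<epsilon> * sin (\<theta> s)" if "0 \<le> s" "s < s1" for s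
    using pos[of s] ends that by (cases "s = 0") auto
  have nonpos: "\<epsilon> * sin (\<theta> s) \<le> 0" if "s1 < s" "s \<le> L" for s
    using neg[of s] ends that by (cases "s = L") auto
  have h_le: "h (k s1) s \<le> 0" if "0 \<le> s" "s \<le> L" for s
  proof -
    consider "s < s1" | "s = s1" | "s1 < s" by linarith
    then show ?thesis
    proof cases
      case 1
      then show ?thesis
        using nonneg[of s] k_mono[of s s1] s1 that by (simp add: h_def mult_nonpos_nonneg)
    next
      case 3
      then show ?thesis
        using nonpos[of s] k_mono[of s1 s] s1 that by (simp add: h_def mult_nonneg_nonpos)
    qed (simp add: h_def)
  qed
  obtain s t where st: "0 < s" "s < t" "t < L" "k s < k t"
    by (rule k_increases_inside)
  \<comment> \<open>A subinterval at one end of the arc where the integrand is below a continuous function that is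
    negative in its interior.
    It lies on the side of \<open>s1\<close> where \<open>k\<close> differs from \<open>k s1\<close>; such a side exists by \<open>k s < k t\<close>.\<close>
  obtain a b m where ab: "0 \<le> a" "a < b" "b \<le> L"
    and le: "\<And>x. x \<in> {a..b} \<Longrightarrow> h (k s1) x \<le> m * (\<epsilon> * sin (\<theta> x))"
    and less: "\<And>x. x \<in> {a<..<b} \<Longrightarrow> m * (\<epsilon> * sin (\<theta> x)) < 0"
  proof (cases "k s < k s1")
    case True
    then have "s < s1" using k_mono[of s1 s] st s1 by fastforce
    show ?thesis
    proof (rule that[of 0 s "k s - k s1"])
      show "h (k s1) x \<le> (k s - k s1) * (\<epsilon> * sin (\<theta> x))" if "x \<in> {0..s}" for x
        unfolding h_def
        by (rule mult_right_mono) (use nonneg[of x] k_mono[of x s] that st \<open>s < s1\<close> in auto)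
      show "(k s - k s1) * (\<epsilon> * sin (\<theta> x)) < 0" if "x \<in> {0<..<s}" for x
        by (rule mult_neg_pos) (use pos[of x] True that \<open>s < s1\<close> in auto)
    qed (use st in auto)
  next
    case False
    then have "k s1 < k t" using st by simp
    then have "s1 < t" using k_mono[of t s1] st s1 by fastforce
    show ?thesis
    proof (rule that[of t L "k t - k s1"])
      show "h (k s1) x \<le> (k t - k s1) * (\<epsilon> * sin (\<theta> x))" if "x \<in> {t..L}" for x
        unfolding h_def
        by (rule mult_right_mono_neg) (use nonpos[of x] k_mono[of t x] that st \<open>s1 < t\<close> in auto)
      show "(k t - k s1) * (\<epsilon> * sin (\<theta> x)) < 0" if "x \<in> {t<..<L}" for x
        by (rule mult_pos_neg) (use neg[of x] \<open>k s1 < k t\<close> that \<open>s1 < t\<close> in auto)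
    qed (use st in auto)
  qed
  have h_int_sub: "h (k s1) integrable_on {x..y}" if "0 \<le> x" "x \<le> y" "y \<le> L" for x y
    by (rule integrable_on_subinterval[OF has_integral_integrable[OF h_int]]) (use that in auto)
  have cont: "continuous_on {a..b} (\<lambda>x. m * (\<epsilon> * sin (\<theta> x)))"
    by (intro continuous_intros continuous_on_subset[OF continuous_\<theta>]) (use ab in auto)
  have "integral {a..b} (h (k s1)) \<le> integral {a..b} (\<lambda>x. m * (\<epsilon> * sin (\<theta> x)))"
    by (rule integral_le) (use le ab h_int_sub integrable_continuous_real[OF cont] in auto)
  also have "\<dots> < integral {a..b} (\<lambda>x. 0)"
    by (rule integral_less_real[OF cont]) (use less ab in auto)
  finally have "integral {a..b} (h (k s1)) < 0" by simp
  moreover have "integral {x..y} (h (k s1)) \<le> 0" if "0 \<le> x" "x \<le> y" "y \<le> L" for x y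
    using integral_le[OF h_int_sub[OF that] integrable_0] h_le that by simp
  from this[of 0 a] this[of b L]
  have "integral {0..a} (h (k s1)) \<le> 0" "integral {b..L} (h (k s1)) \<le> 0"
    using ab by auto
  moreover have "integral {0..L} (h (k s1)) =
      integral {0..a} (h (k s1)) + integral {a..b} (h (k s1)) + integral {b..L} (h (k s1))"
    using ab h_int_sub
      Henstock_Kurzweil_Integration.integral_combine[of 0 a b "h (k s1)"]
      Henstock_Kurzweil_Integration.integral_combine[of 0 b L "h (k s1)"] by simp
  ultimately have "integral {0..L} (h (k s1)) < 0" by linarith
  then show ?thesis
    using integral_unique[OF h_int[of "k s1"]] by (simp add: \<epsilon>_def)
qed

text \<open>
  On \<open>{0..pi}\<close> the cosine decreases. For boundary angles of opposite signs the comparison of cosines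
  therefore shows that the positive one exceeds the other one in absolute value.
\<close>
lemma angle_sum_pos: "0 < \<theta> 0 + \<theta> L"
proof (cases "\<theta> 0 * \<theta> L < 0")
  case False
  then show ?thesis
    using not_both_ends_nonpos by (auto simp: mult_less_0_iff not_less)
next
  case True
  have b: "-pi \<le> \<theta> 0" "\<theta> 0 \<le> pi" "-pi \<le> \<theta> L" "\<theta> L \<le> pi"
    using \<theta>_bounds_closed[of 0] \<theta>_bounds_closed[of L] L_pos by auto
  show ?thesis
  proof (cases "0 < \<theta> 0")
    case pos: True
    then have "cos (\<theta> 0) < cos (- \<theta> L)" "\<theta> L < 0"
      using cos_ends_strict[OF True] True by (auto simp: mult_less_0_iff)
    then show ?thesis
      using cos_mono_less_eq[of "\<theta> 0" "- \<theta> L"] b pos by simp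
  next
    case False
    then have "\<theta> 0 < 0" "cos (\<theta> L) < cos (- \<theta> 0)" "0 < \<theta> L"
      using cos_ends_strict[OF True] True by (auto simp: mult_less_0_iff)
    then show ?thesis
      using cos_mono_less_eq[of "\<theta> L" "- \<theta> 0"] b by simp
  qed
qed

end

section \<open>Boundary data of short spirals\<close>

text \<open>
  The image of the interval under \<open>\<theta>\<close> is connected and contains no odd multiple of \<open>pi\<close>.
\<close>
lemma angle_shift:
  fixes \<theta> :: "real \<Rightarrow> real"
  assumes cont: "continuous_on {a<..<b} \<theta>" and ab: "a < b"
    and avoid: "\<And>s. s \<in> {a<..<b} \<Longrightarrow> cis (\<theta> s) \<noteq> -1"
  obtains n :: int where "\<And>s. s \<in> {a<..<b} \<Longrightarrow> -pi < \<theta> s - 2 * pi * n \<and> \<theta> s - 2 * pi * n < pi"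
proof -
  define n where "n = \<lfloor>(\<theta> ((a + b) / 2) + pi) / (2 * pi)\<rfloor>"
  define \<phi> where "\<phi> = (\<lambda>s. \<theta> s - 2 * pi * n)"
  have mid: "(a + b) / 2 \<in> {a<..<b}" using ab by simp
  have "cis (\<phi> s) = cis (\<theta> s)" for s
    using cis_multiple_2pi[of "real_of_int n"] by (simp add: \<phi>_def cis_divide[symmetric])
  then have ne: "\<phi> s \<noteq> pi" "\<phi> s \<noteq> -pi" if "s \<in> {a<..<b}" for s
    using avoid[OF that] by (metis cis_pi, metis cis_pi cis_cnj complex_cnj_minus complex_cnj_one)
  have "real_of_int n \<le> (\<theta> ((a + b) / 2) + pi) / (2 * pi)"
    "(\<theta> ((a + b) / 2) + pi) / (2 * pi) < real_of_int n + 1"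
    by (simp_all add: n_def)
  then have mid_bounds: "-pi \<le> \<phi> ((a + b) / 2)" "\<phi> ((a + b) / 2) < pi"
    by (simp_all add: \<phi>_def field_simps)
  have "connected (\<phi> ` {a<..<b})"
    unfolding \<phi>_def by (intro connected_continuous_image continuous_intros cont) auto
  then have between: "y \<in> \<phi> ` {a<..<b}"
    if "u \<in> \<phi> ` {a<..<b}" "v \<in> \<phi> ` {a<..<b}" "u \<le> y" "y \<le> v" for u v y
    using that connected_contains_Icc by (metis atLeastAtMost_iff subsetD)
  have "-pi < \<phi> s \<and> \<phi> s < pi" if s: "s \<in> {a<..<b}" for s
  proof (rule ccontr)
    assume "\<not> ?thesis"
    then have "pi \<in> \<phi> ` {a<..<b} \<or> -pi \<in> \<phi> ` {a<..<b}"
      using between[of "\<phi> ((a + b) / 2)" "\<phi> s" pi] between[of "\<phi> s" "\<phi> ((a + b) / 2)" "-pi"]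
        mid s mid_bounds by fastforce
    then show False using ne by (metis imageE)
  qed
  then show ?thesis unfolding \<phi>_def by (rule that)
qed

text \<open>
  Two angles of the same direction in \<open>{-pi..pi}\<close> can differ only if one is \<open>-pi\<close> and the other \<open>pi\<close>.
  The normalization for increasing curvature chooses \<open>pi\<close>, which can only enlarge \<open>\<alpha> + \<beta>\<close>.
\<close>
lemma normalized_angle_ge:
  assumes "cis \<alpha> = cis t" "-pi < \<alpha>" "\<alpha> \<le> pi" "-pi \<le> t" "t \<le> pi"
  shows "t \<le> \<alpha>"
proof (cases "t = -pi")
  case False
  then have "t = \<alpha>"
    using cis_Arg_unique[of "cis t" t] cis_Arg_unique[of "cis t" \<alpha>] assms by simp
  then show ?thesis by simp
qed (use assms in simp)

lemma increasing_short_spiral_boundary: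
  assumes "short_spiral L z \<theta> k" and mono: "mono_on {0..L} k"
    and ends: "z 0 = -1" "z L = 1"
    and bdry: "circle_of_curvature z \<theta> k 0 (OCircle (-1) 0 \<alpha> a)"
      "circle_of_curvature z \<theta> k L (OCircle 1 0 \<beta> b)"
    and angles: "\<alpha> \<in> {-pi<..pi}" "\<beta> \<in> {-pi<..pi}"
  shows "a + sin \<alpha> < 0" "0 < b - sin \<beta>" "0 < \<alpha> + \<beta>"
proof -
  have arc: "arc_with_curvature L z \<theta> k" and nonconst: "\<not> k constant_on {0..L}"
    and short: "\<And>s. s \<in> {0<..<L} \<Longrightarrow> cis (\<theta> s) \<noteq> -1"
    using assms(1) ends by (auto simp: short_spiral_def spiral_arc_def short_arc_def sgn_div_norm scaleR_conv_of_real)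
  interpret \<theta>: increasing_arc L z \<theta> k
    by standard (use arc mono in auto)
  obtain n :: int where n: "\<And>s. s \<in> {0<..<L} \<Longrightarrow> -pi < \<theta> s - 2 * pi * n \<and> \<theta> s - 2 * pi * n < pi"
    by (rule angle_shift[OF continuous_on_subset[OF \<theta>.continuous_\<theta>] \<theta>.L_pos short]) auto
  define \<phi> where "\<phi> = (\<lambda>s. \<theta> s - 2 * pi * n)"
  have cis: "cis (\<phi> s) = cis (\<theta> s)" for s
    using cis_multiple_2pi[of "real_of_int n"] by (simp add: \<phi>_def cis_divide[symmetric])
  interpret short_increasing_spiral L z \<phi> k
  proof
    show "arc_with_curvature L z \<phi> k"
      using arc by (simp add: arc_with_curvature_def cis) (simp add: \<phi>_def)
  qed (use mono nonconst ends n in \<open>auto simp: \<phi>_def\<close>)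
  have \<alpha>: "cis \<alpha> = cis (\<phi> 0)" "k 0 = a" and \<beta>: "cis \<beta> = cis (\<phi> L)" "k L = b"
    using bdry by (auto simp: circle_of_curvature_def cis)
  have "\<phi> 0 \<le> \<alpha>" "\<phi> L \<le> \<beta>"
    using normalized_angle_ge[OF \<alpha>(1)] normalized_angle_ge[OF \<beta>(1)] angles
      \<theta>_bounds_closed[of 0] \<theta>_bounds_closed[of L] L_pos by auto
  then show "0 < \<alpha> + \<beta>"
    using angle_sum_pos by simp
  have "sin \<alpha> = sin (\<phi> 0)" "sin \<beta> = sin (\<phi> L)"
    using \<alpha>(1) \<beta>(1) by (metis cis.sel(2))+
  then have "osculating_power 1 0 = 4 * (a + sin \<alpha>)" "osculating_power (-1) L = 4 * (b - sin \<beta>)"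
    "osculating_power 1 L = 0" "osculating_power (-1) 0 = 0"
    using \<alpha>(2) \<beta>(2) ends by (simp_all add: osculating_power_def)
  then show "a + sin \<alpha> < 0" "0 < b - sin \<beta>"
    using osculating_power_strict_increase[of 1] osculating_power_strict_increase[of "-1"] ends by auto
qed

lemma short_spiral_cnj:
  assumes "short_spiral L z \<theta> k"
  shows "short_spiral L (cnj \<circ> z) (\<lambda>s. - \<theta> s) (\<lambda>s. - k s)"
proof -
  have arc: "arc_with_curvature L z \<theta> k" and monotone: "mono_on {0..L} k \<or> antimono_on {0..L} k"
    and nonconst: "\<not> k constant_on {0..L}"
    and short: "\<And>s. s \<in> {0<..<L} \<Longrightarrow> cis (\<theta> s) \<noteq> sgn (z 0 - z L)"
    using assms by (auto simp: short_spiral_def spiral_arc_def short_arc_def)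
  have "((cnj \<circ> z) has_vector_derivative cis (- \<theta> s)) (at s within {0..L})" if "s \<in> {0..L}" for s
  proof -
    have "((\<lambda>s. cnj (z s)) has_vector_derivative cnj (cis (\<theta> s))) (at s within {0..L})"
      by (rule has_vector_derivative_cnj) (use arc that in \<open>simp add: arc_with_curvature_def\<close>)
    then show ?thesis by (simp add: cis_cnj o_def)
  qed
  moreover have "((\<lambda>s. - k s) has_integral (- \<theta> s - - \<theta> 0)) {0..s}" if "s \<in> {0..L}" for s
  proof -
    have "(k has_integral (\<theta> s - \<theta> 0)) {0..s}"
      using arc that by (simp add: arc_with_curvature_def)
    from has_integral_neg[OF this] show ?thesis by simp
  qed
  ultimately have "arc_with_curvature L (cnj \<circ> z) (\<lambda>s. - \<theta> s) (\<lambda>s. - k s)"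
    using arc by (auto simp: arc_with_curvature_def intro!: continuous_minus)
  moreover have "mono_on {0..L} (\<lambda>s. - k s) \<or> antimono_on {0..L} (\<lambda>s. - k s)"
    using monotone by (auto simp: monotone_on_def)
  moreover have "\<not> (\<lambda>s. - k s) constant_on {0..L}"
    using nonconst unfolding constant_on_def by (metis minus_minus)
  moreover have "cis (- \<theta> s) \<noteq> sgn ((cnj \<circ> z) 0 - (cnj \<circ> z) L)" if "s \<in> {0<..<L}" for s
  proof
    assume "cis (- \<theta> s) = sgn ((cnj \<circ> z) 0 - (cnj \<circ> z) L)"
    then have "cnj (cis (- \<theta> s)) = cnj (sgn (cnj (z 0 - z L)))" by simp
    also have "sgn (cnj (z 0 - z L)) = cnj (sgn (z 0 - z L))"
      by (simp add: sgn_div_norm del: complex_cnj_diff)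
    finally show False using short[OF that] by (simp add: cis_cnj)
  qed
  ultimately show ?thesis
    by (auto simp: short_spiral_def spiral_arc_def short_arc_def)
qed

lemma decreasing_short_spiral_boundary:
  assumes spiral: "short_spiral L z \<theta> k" and anti: "antimono_on {0..L} k"
    and ends: "z 0 = -1" "z L = 1"
    and bdry: "circle_of_curvature z \<theta> k 0 (OCircle (-1) 0 \<alpha> a)"
      "circle_of_curvature z \<theta> k L (OCircle 1 0 \<beta> b)"
    and angles: "\<alpha> \<in> {-pi..<pi}" "\<beta> \<in> {-pi..<pi}"
  shows "0 < a + sin \<alpha>" "b - sin \<beta> < 0" "\<alpha> + \<beta> < 0"
proof -
  have neg: "cis (- x) = cis (- y)" if "cis x = cis y" for x y
    using that by (metis cis_cnj)
  have "mono_on {0..L} (\<lambda>s. - k s)"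
    using anti by (simp add: monotone_on_def)
  moreover have "circle_of_curvature (cnj \<circ> z) (\<lambda>s. - \<theta> s) (\<lambda>s. - k s) 0 (OCircle (-1) 0 (-\<alpha>) (-a))"
    "circle_of_curvature (cnj \<circ> z) (\<lambda>s. - \<theta> s) (\<lambda>s. - k s) L (OCircle 1 0 (-\<beta>) (-b))"
    using bdry ends neg by (auto simp: circle_of_curvature_def circ_point_def complex_eq_iff)
  ultimately show "0 < a + sin \<alpha>" "b - sin \<beta> < 0" "\<alpha> + \<beta> < 0"
    using increasing_short_spiral_boundary[OF short_spiral_cnj[OF spiral], of "-\<alpha>" "-a" "-\<beta>" "-b"]
      ends angles by auto
qed

text \<open>
  The sign of \<open>\<alpha> + \<beta>\<close> tells increasing from decreasing curvature, and thereby fixes the signs of the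
  two powers.
\<close>
lemma short_spiral_boundary_signs:
  assumes spiral: "short_spiral L z \<theta> k" and ends: "z 0 = -1" "z L = 1"
    and bdry: "circle_of_curvature z \<theta> k 0 (OCircle (-1) 0 \<alpha> a)"
      "circle_of_curvature z \<theta> k L (OCircle 1 0 \<beta> b)"
    and angles: "normalized_angles L k \<alpha> \<beta>"
  shows "a + sin \<alpha> < 0 \<and> 0 < b - sin \<beta> \<and> 0 < \<alpha> + \<beta> \<or>
    0 < a + sin \<alpha> \<and> b - sin \<beta> < 0 \<and> \<alpha> + \<beta> < 0"
proof (cases "mono_on {0..L} k")
  case True
  then show ?thesis
    using increasing_short_spiral_boundary[OF spiral True ends bdry] angles
    by (simp add: normalized_angles_def)
next
  case False
  then have "antimono_on {0..L} k"
    using spiral by (auto simp: short_spiral_def spiral_arc_def)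
  then show ?thesis
    using decreasing_short_spiral_boundary[OF spiral _ ends bdry] angles
    by (simp add: normalized_angles_def)
qed

section \<open>Images of oriented circles\<close>

lemma circ_curve_vector_derivative:
  "(circ_curve C has_vector_derivative cis (circ_angle C + circ_curv C * s)) (at s)"
proof (cases "circ_curv C = 0")
  case True
  then show ?thesis
    by (auto simp: circ_curve_def[abs_def] intro!: derivative_eq_intros)
next
  case False
  have "circ_curve C = (\<lambda>s. cis (circ_angle C + circ_curv C * s) / (\<i> * of_real (circ_curv C))
      + (circ_point C - cis (circ_angle C) / (\<i> * of_real (circ_curv C))))"
    using False by (auto simp: circ_curve_def fun_eq_iff cis_mult[symmetric] field_simps)
  moreover have "((\<lambda>s. cis (circ_angle C + circ_curv C * s) / (\<i> * of_real (circ_curv C))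
      + (circ_point C - cis (circ_angle C) / (\<i> * of_real (circ_curv C)))) has_vector_derivative
      cis (circ_angle C + circ_curv C * s) + 0) (at s)"
    by (intro has_vector_derivative_add has_vector_derivative_const cis_affine_antiderivative False)
  ultimately show ?thesis by simp
qed

lemma circ_curve_0 [simp]: "circ_curve C 0 = circ_point C"
  by (simp add: circ_curve_def)

text \<open>
  With unit tangent \<open>t\<close> and curvature \<open>\<kappa>\<close>, the image curve has velocity \<open>g = f' * t\<close> and acceleration
  \<open>f'' * t\<^sup>2 + f' * \<i> * \<kappa> * t = g * (f'' / f' * t + \<i> * \<kappa>)\<close>. Dividing by \<open>norm g\<close> cubed, where
  \<open>norm g = norm f' = r\<close>, gives the transformation law of the curvature.
\<close>
lemma has_direction_curvature_image:
  fixes f f1 :: "complex \<Rightarrow> complex"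
  assumes S: "open S" "circ_point C \<in> S"
    and f: "\<And>w. w \<in> S \<Longrightarrow> (f has_field_derivative f1 w) (at w)"
    and f1: "(f1 has_field_derivative f2) (at (circ_point C))"
    and f1_eq: "f1 (circ_point C) = of_real r * cis \<mu>" and r: "0 < r"
  shows "has_direction_curvature (f \<circ> circ_curve C) 0 (circ_angle C + \<mu>)
    ((circ_curv C + Im (f2 / f1 (circ_point C) * cis (circ_angle C))) / r)"
proof -
  define t where "t = (\<lambda>s. cis (circ_angle C + circ_curv C * s))"
  define g where "g = (\<lambda>s. f1 (circ_curve C s) * t s)"
  define p where "p = circ_point C"
  define w where "w = f2 * t 0 * t 0 + f1 p * (\<i> * circ_curv C * t 0)"
  have curve: "(circ_curve C has_vector_derivative t s) (at s)" for s
    unfolding t_def by (rule circ_curve_vector_derivative)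
  have "isCont (circ_curve C) 0"
    using has_vector_derivative_continuous[OF curve] .
  then have "(circ_curve C \<longlongrightarrow> circ_curve C 0) (nhds 0)"
    unfolding isCont_def tendsto_at_iff_tendsto_nhds .
  then have "\<forall>\<^sub>F s in nhds 0. circ_curve C s \<in> S"
    by (rule topological_tendstoD) (use S in simp_all)
  then have ev: "\<forall>\<^sub>F s in nhds 0. ((f \<circ> circ_curve C) has_vector_derivative g s) (at s)"
  proof eventually_elim
    case (elim s)
    show ?case
      using field_vector_diff_chain_at[OF curve f[OF elim]] by (simp add: g_def mult.commute)
  qed
  have "(t has_vector_derivative \<i> * circ_curv C * t 0) (at 0)"
    unfolding t_def has_vector_derivative_def
    by (auto intro!: derivative_eq_intros simp: fun_eq_iff scaleR_conv_of_real)
  moreover have "((f1 \<circ> circ_curve C) has_vector_derivative t 0 * f2) (at 0)"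
    by (rule field_vector_diff_chain_at[OF curve]) (simp add: f1)
  ultimately have g_deriv: "(g has_vector_derivative w) (at 0)"
    unfolding g_def w_def p_def
    using has_vector_derivative_mult[of "f1 \<circ> circ_curve C" "t 0 * f2" 0 UNIV t "\<i> * circ_curv C * t 0"]
    by (simp add: algebra_simps)
  have t0: "t 0 = cis (circ_angle C)" by (simp add: t_def)
  have g0: "g 0 = of_real r * cis (circ_angle C + \<mu>)"
    using f1_eq by (simp add: g_def t0 cis_mult algebra_simps)
  have norm_g0: "norm (g 0) = r" using r by (simp add: g0 norm_mult)
  have sgn_g0: "sgn (g 0) = cis (circ_angle C + \<mu>)"
    using r norm_g0 by (simp add: sgn_div_norm g0 scaleR_conv_of_real)
  have "f1 p \<noteq> 0" using f1_eq r by (simp add: p_def)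
  have "cnj (g 0) * g 0 = of_real (r\<^sup>2)"
    using norm_g0 by (metis complex_norm_square mult.commute)
  moreover have "w = g 0 * (f2 / f1 p * t 0 + \<i> * circ_curv C)"
    using \<open>f1 p \<noteq> 0\<close> by (simp add: w_def g_def p_def field_simps)
  ultimately have "cnj (g 0) * w = of_real (r\<^sup>2) * (f2 / f1 p * t 0 + \<i> * circ_curv C)"
    by (metis mult.assoc)
  then have "Im (cnj (g 0) * w) = r\<^sup>2 * (Im (f2 / f1 p * t 0) + circ_curv C)"
    by simp
  then have "Im (cnj (g 0) * w) / norm (g 0) ^ 3 =
      (circ_curv C + Im (f2 / f1 p * cis (circ_angle C))) / r"
    using r by (simp add: norm_g0 t0 field_simps power2_eq_square power3_eq_cube)
  then show ?thesis
    unfolding has_direction_curvature_def using ev g_deriv sgn_g0 norm_g0 r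
    by (intro exI[of _ g] exI[of _ w]) (auto simp: p_def)
qed

text \<open>
  The Moebius map that fixes \<open>1\<close> and \<open>-1\<close> and multiplies the coordinate \<open>(w + 1) / (w - 1)\<close> by \<open>\<rho>\<close>:
  the image \<open>v\<close> satisfies \<open>(v + 1) / (v - 1) = \<rho> * (w + 1) / (w - 1)\<close>. In this form the
  parameter \<open>z0 = \<infinity>\<close>, that is \<open>\<rho> = -1\<close>, needs no separate treatment.
\<close>
definition moebius_fix :: "complex \<Rightarrow> complex \<Rightarrow> complex" where
  "moebius_fix \<rho> w = (\<rho> * (w + 1) + (w - 1)) / (\<rho> * (w + 1) - (w - 1))"

lemma W_eq_moebius_fix: "W w (ext_quot (\<rho> - 1) (\<rho> + 1)) = moebius_fix \<rho> w"
proof (cases "\<rho> + 1 = 0")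
  case True
  then have "\<rho> = -1" by (simp add: add_eq_0_iff2)
  then show ?thesis
    by (simp add: ext_quot_def moebius_fix_def)
next
  case False
  have "(w + (\<rho> - 1) / (\<rho> + 1)) / (1 + (\<rho> - 1) / (\<rho> + 1) * w) =
    ((\<rho> + 1) * (w + (\<rho> - 1) / (\<rho> + 1))) / ((\<rho> + 1) * (1 + (\<rho> - 1) / (\<rho> + 1) * w))"
    using False by simp
  also have "\<dots> = moebius_fix \<rho> w"
  proof -
    have "(\<rho> + 1) * (w + (\<rho> - 1) / (\<rho> + 1)) = (\<rho> + 1) * w + (\<rho> - 1)"
      "(\<rho> + 1) * (1 + (\<rho> - 1) / (\<rho> + 1) * w) = (\<rho> + 1) + (\<rho> - 1) * w"
      using False by (simp_all add: distrib_left)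
    then show ?thesis
      by (simp only:) (simp add: moebius_fix_def algebra_simps)
  qed
  finally show ?thesis
    using False by (simp add: ext_quot_def)
qed

text \<open>
  Here \<open>d\<close> is the denominator of the map at its fixed point \<open>p\<close>, where the first derivative is
  \<open>4 * \<rho> / d\<^sup>2\<close> and the ratio of the second to the first is \<open>- 2 * (\<rho> - 1) / d\<close>.
\<close>
lemma maps_ocircle_moebius_fix:
  assumes p: "circ_point C = p" "circ_point C' = p" "moebius_fix \<rho> p = p"
    and d: "d = \<rho> * (p + 1) - (p - 1)" "d \<noteq> 0"
    and deriv: "4 * \<rho> / d\<^sup>2 = of_real r * cis \<mu>" and r: "0 < r"
    and angle: "circ_angle C' = circ_angle C + \<mu>"
    and curv: "circ_curv C' = (circ_curv C + Im (-2 * (\<rho> - 1) / d * cis (circ_angle C))) / r"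
  shows "maps_ocircle (\<lambda>w. W w (ext_quot (\<rho> - 1) (\<rho> + 1))) C C'"
proof -
  define D where "D = (\<lambda>w. \<rho> * (w + 1) - (w - 1))"
  define S where "S = {w. D w \<noteq> 0}"
  have "open S"
    unfolding S_def D_def by (intro open_Collect_neq continuous_intros)
  have "p \<in> S" "D p = d" using d by (simp_all add: S_def D_def)
  have "(moebius_fix \<rho> has_field_derivative 4 * \<rho> / (D w)\<^sup>2) (at w)" if "w \<in> S" for w
    using that unfolding moebius_fix_def[abs_def] S_def D_def
    by (auto intro!: derivative_eq_intros simp: power2_eq_square algebra_simps)
  moreover have "((\<lambda>w. 4 * \<rho> / (D w)\<^sup>2) has_field_derivative - 8 * \<rho> * (\<rho> - 1) / d ^ 3) (at p)"
    using d unfolding D_def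
    by (auto intro!: derivative_eq_intros simp: divide_simps) (simp add: algebra_simps eval_nat_numeral)
  ultimately have "has_direction_curvature (moebius_fix \<rho> \<circ> circ_curve C) 0 (circ_angle C + \<mu>)
    ((circ_curv C + Im ((- 8 * \<rho> * (\<rho> - 1) / d ^ 3) / (4 * \<rho> / (D (circ_point C))\<^sup>2)
      * cis (circ_angle C))) / r)"
    by (intro has_direction_curvature_image[OF \<open>open S\<close>])
      (simp_all only: p(1) \<open>p \<in> S\<close> \<open>D p = d\<close> deriv r)
  moreover have "\<rho> \<noteq> 0" using deriv r by auto
  then have "(- 8 * \<rho> * (\<rho> - 1) / d ^ 3) / (4 * \<rho> / (D (circ_point C))\<^sup>2) = -2 * (\<rho> - 1) / d"
    using d(2) unfolding p(1) \<open>D p = d\<close> by (simp add: field_simps eval_nat_numeral)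
  ultimately have "has_direction_curvature (moebius_fix \<rho> \<circ> circ_curve C) 0
      (circ_angle C') (circ_curv C')"
    by (simp only: angle curv)
  then show ?thesis
    unfolding W_eq_moebius_fix maps_ocircle_def using p by simp
qed

section \<open>Transforming one pair of boundary circles into the other\<close>

theorem proposition1:
  fixes L L' :: real and z z' :: "real \<Rightarrow> complex" and \<theta> \<theta>' k k' :: "real \<Rightarrow> real"
    and \<alpha> a \<beta> b \<alpha>' a' \<beta>' b' :: real and K1 K2 K1' K2' :: ocircle
  assumes K1: "K1 = OCircle (-1) 0 \<alpha> a" and K2: "K2 = OCircle 1 0 \<beta> b"
    and K1': "K1' = OCircle (-1) 0 \<alpha>' a'" and K2': "K2' = OCircle 1 0 \<beta>' b'"
    and spiral: "short_spiral L z \<theta> k" "z 0 = -1" "z L = 1"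
    and bdry: "circle_of_curvature z \<theta> k 0 K1" "circle_of_curvature z \<theta> k L K2"
    and angles: "normalized_angles L k \<alpha> \<beta>"
    and spiral': "short_spiral L' z' \<theta>' k'" "z' 0 = -1" "z' L' = 1"
    and bdry': "circle_of_curvature z' \<theta>' k' 0 K1'" "circle_of_curvature z' \<theta>' k' L' K2'"
    and angles': "normalized_angles L' k' \<alpha>' \<beta>'"
    and sigma_eq: "sigma K1 K2 = sigma K1' K2'"
    and Q_eq: "Qinv K1 K2 = Qinv K1' K2'"
  shows "let lam0 = \<alpha>' - \<alpha>;
             r0 = (a + sin \<alpha>) / (a' + sin \<alpha>');
             z0 = ext_quot (of_real r0 * cis lam0 - 1) (of_real r0 * cis lam0 + 1)
         in lam0 = \<beta> - \<beta>' \<and>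
            r0 = (b' - sin \<beta>') / (b - sin \<beta>) \<and> 0 < r0 \<and>
            maps_ocircle (\<lambda>w. W w z0) K1 K1' \<and>
            maps_ocircle (\<lambda>w. W w z0) K2 K2'"
proof -
  define A B A' B' where "A = a + sin \<alpha>" and "B = b - sin \<beta>"
    and "A' = a' + sin \<alpha>'" and "B' = b' - sin \<beta>'"
  have sum: "\<alpha> + \<beta> = \<alpha>' + \<beta>'"
    using sigma_eq by (simp add: sigma_def K1 K2 K1' K2')
  have prod: "A * B = A' * B'"
    using Q_eq by (simp add: Qinv_def K1 K2 K1' K2' sum A_def B_def A'_def B'_def)
  have signs: "A < 0 \<and> 0 < B \<and> A' < 0 \<and> 0 < B' \<or> 0 < A \<and> B < 0 \<and> 0 < A' \<and> B' < 0"
    using short_spiral_boundary_signs[OF spiral bdry[unfolded K1 K2] angles]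
      short_spiral_boundary_signs[OF spiral' bdry'[unfolded K1' K2'] angles'] sum
    unfolding A_def B_def A'_def B'_def by linarith
  then have nz: "A \<noteq> 0" "B \<noteq> 0" "A' \<noteq> 0" "B' \<noteq> 0" by auto
  define lam0 r0 \<rho> where "lam0 = \<alpha>' - \<alpha>" and "r0 = A / A'" and "\<rho> = of_real r0 * cis lam0"
  have r0: "0 < r0" and r0_eq: "r0 = B' / B"
    using signs prod nz by (auto simp: r0_def zero_less_divide_iff frac_eq_eq mult.commute)
  have "\<rho> \<noteq> 0" using r0 by (simp add: \<rho>_def)
  have \<rho>_\<alpha>: "\<rho> * cis \<alpha> = of_real r0 * cis \<alpha>'"
    by (simp add: \<rho>_def lam0_def mult.assoc cis_mult)
  have inv_\<rho>: "1 / \<rho> = of_real (1 / r0) * cis (- lam0)"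
    by (simp add: \<rho>_def divide_inverse)
  have \<rho>_\<beta>: "1 / \<rho> * cis \<beta> = of_real (1 / r0) * cis \<beta>'"
  proof -
    have "- lam0 + \<beta> = \<beta>'" using sum by (simp add: lam0_def)
    then show ?thesis unfolding inv_\<rho> by (simp only: mult.assoc cis_mult)
  qed
  have map1: "maps_ocircle (\<lambda>w. W w (ext_quot (\<rho> - 1) (\<rho> + 1))) K1 K1'"
  proof (rule maps_ocircle_moebius_fix[where p = "-1" and d = 2 and r = r0 and \<mu> = lam0])
    have "- 2 * (\<rho> - 1) / 2 * cis \<alpha> = cis \<alpha> - \<rho> * cis \<alpha>"
      by (simp add: field_simps)
    then have "Im (- 2 * (\<rho> - 1) / 2 * cis \<alpha>) = sin \<alpha> - r0 * sin \<alpha>'"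
      by (simp only: \<rho>_\<alpha>) simp
    moreover have "a + sin \<alpha> = r0 * (a' + sin \<alpha>')"
      using nz by (simp add: r0_def A_def A'_def)
    ultimately show "circ_curv K1' = (circ_curv K1 + Im (- 2 * (\<rho> - 1) / 2 * cis (circ_angle K1))) / r0"
      using r0 by (simp only: K1 K1' ocircle.sel) (simp add: field_simps)
  qed (use r0 in \<open>simp_all add: K1 K1' circ_point_def complex_eq_iff moebius_fix_def \<rho>_def lam0_def\<close>)
  have map2: "maps_ocircle (\<lambda>w. W w (ext_quot (\<rho> - 1) (\<rho> + 1))) K2 K2'"
  proof (rule maps_ocircle_moebius_fix[where p = 1 and d = "2 * \<rho>" and r = "1 / r0" and \<mu> = "- lam0"])
    have "- 2 * (\<rho> - 1) / (2 * \<rho>) * cis \<beta> = 1 / \<rho> * cis \<beta> - cis \<beta>"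
      using \<open>\<rho> \<noteq> 0\<close> by (simp add: field_simps)
    then have Im_eq: "Im (- 2 * (\<rho> - 1) / (2 * \<rho>) * cis \<beta>) = 1 / r0 * sin \<beta>' - sin \<beta>"
      by (simp only: \<rho>_\<beta>) simp
    have "b' - sin \<beta>' = r0 * (b - sin \<beta>)"
      using nz by (simp add: r0_eq B_def B'_def)
    then have "b' = sin \<beta>' + r0 * b - r0 * sin \<beta>" by (simp add: right_diff_distrib)
    then show "circ_curv K2' =
        (circ_curv K2 + Im (- 2 * (\<rho> - 1) / (2 * \<rho>) * cis (circ_angle K2))) / (1 / r0)"
      using r0 by (simp only: K2 K2' ocircle.sel Im_eq) (simp add: field_simps)
    show "4 * \<rho> / (2 * \<rho>)\<^sup>2 = of_real (1 / r0) * cis (- lam0)"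
      unfolding inv_\<rho>[symmetric] using \<open>\<rho> \<noteq> 0\<close> by (simp add: power2_eq_square)
  qed (use r0 sum \<open>\<rho> \<noteq> 0\<close> in
      \<open>simp_all add: K2 K2' circ_point_def complex_eq_iff moebius_fix_def lam0_def\<close>)
  have "lam0 = \<beta> - \<beta>'"
    using sum by (simp add: lam0_def)
  then show ?thesis
    using map1 map2 r0 r0_eq
    unfolding Let_def \<rho>_def lam0_def r0_def A_def A'_def B_def B'_def by blast
qed

end
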